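(* Let $1\leq s<\theta$. For any fixed $t>0$, the function $h(\xi)=e^{-it\xi^2}$, $\xi\in\mathbb{R}$, does not define a multiplier in $\mathcal{S}^s_\theta(\mathbb{R})$.
   Context: The Gelfand-Shilov space $\mathcal{S}^{s}_{\theta}(\mathbb{R})$ (upper index $s$: Gevrey regularity; lower index $\theta$: decay) is the space of all smooth functions $f:\mathbb{R}\to\mathbb{C}$ for which there exist constants $C,c>0$ such that $$\sup_{\xi\in\mathbb{R},\,\beta\in\mathbb{N}_0}|\partial_\xi^\beta f(\xi)|\,C^{-\beta}\,\beta!^{-s}\,e^{c|\xi|^{1/\theta}}<\infty,$$ where $\mathbb{N}_0=\{0,1,2,\dots\}$. A function $h$ defines a multiplier in $\mathcal{S}^s_\theta(\mathbb{R})$ if $hf\in\mathcal{S}^s_\theta(\mathbb{R})$ for every $f\in\mathcal{S}^s_\theta(\mathbb{R})$. *)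

theory Defs
  imports "HOL-Analysis.Analysis"
begin

definition nth_vector_derivative ::
    "nat \<Rightarrow> (real \<Rightarrow> 'a::real_normed_vector) \<Rightarrow> real \<Rightarrow> 'a" where
  "nth_vector_derivative n f = ((\<lambda>g x. vector_derivative g (at x)) ^^ n) f"

(* vector_derivative is a choice operator, so the differentiability of every iterate has to
   be demanded explicitly; continuity of all iterates follows. *)
definition smooth :: "(real \<Rightarrow> 'a::real_normed_vector) \<Rightarrow> bool" where
  "smooth f \<longleftrightarrow> (\<forall>n x. nth_vector_derivative n f differentiable (at x))"

(* First argument: Gevrey regularity s (upper index); second argument: decay theta (lower index).
   Finiteness of the supremum is expressed by bdd_above, since Sup on the reals is
   unspecified for unbounded sets. *)
definition gelfand_shilov :: "real \<Rightarrow> real \<Rightarrow> (real \<Rightarrow> complex) set" where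
  "gelfand_shilov s \<theta> =
    {f. smooth f \<and>
        (\<exists>C>0. \<exists>c>0.
          bdd_above (range (\<lambda>(\<xi>::real, \<beta>::nat).
            norm (nth_vector_derivative \<beta> f \<xi>) * C powr (- real \<beta>) * (fact \<beta>) powr (- s)
              * exp (c * \<bar>\<xi>\<bar> powr (1 / \<theta>)))))}"

definition gelfand_shilov_multiplier :: "real \<Rightarrow> real \<Rightarrow> (real \<Rightarrow> complex) \<Rightarrow> bool" where
  "gelfand_shilov_multiplier s \<theta> h \<longleftrightarrow>
    (\<forall>f \<in> gelfand_shilov s \<theta>. (\<lambda>\<xi>. h \<xi> * f \<xi>) \<in> gelfand_shilov s \<theta>)"

end

theory Submission
  imports Defs "HOL-Complex_Analysis.Cauchy_Integral_Formula" "HOL-Real_Asymp.Real_Asymp"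
begin

text \<open>
  The obstruction is that \<open>h\<close> oscillates at frequency \<open>2 t \<xi>\<close> near \<open>\<xi>\<close>, so \<open>n\<close> derivatives of
  \<open>h f\<close> cost \<open>(2 t \<xi>) ^ n\<close>, while \<open>f\<close> may decay as slowly as \<open>exp (- \<bar>\<xi>\<bar> powr (1 / \<theta>))\<close>.
  At \<open>\<xi> = n powr \<theta>\<close> the decay only costs an exponential factor in \<open>n\<close>, so the \<open>n\<close>-th derivative
  has size about \<open>n powr (\<theta> n)\<close>, which exceeds \<open>C ^ n * fact n powr s\<close> when \<open>\<theta> > s\<close>.

  The witness \<open>f \<xi> = exp (- (1 + \<xi>\<^sup>2) powr (1 / (2 * \<theta>)))\<close> extends holomorphically to the strip
  \<open>\<bar>Im z\<bar> < 1\<close> and is comparable to its central value on discs of radius \<open>1 / 2\<close>, so Cauchy's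
  inequality puts it in the space. For the lower bound write
  \<open>z\<^sup>2 = 2 \<xi> z - \<xi>\<^sup>2 + (z - \<xi>)\<^sup>2\<close> and expand the derivatives of
  \<open>exp (- \<i> t (2 \<xi> z - \<xi>\<^sup>2)) * (exp (- \<i> t (z - \<xi>)\<^sup>2) * f z)\<close> by Leibniz' rule: when \<open>\<xi>\<close> is large
  compared to \<open>n\<close>, the term in which every derivative hits the first factor dominates.
\<close>

section \<open>Derivatives along the real line of holomorphic functions\<close>

lemma nth_vector_derivative_of_real:
  assumes "F holomorphic_on S" "open S" "range complex_of_real \<subseteq> S"
  shows "nth_vector_derivative n (\<lambda>x. F (of_real x)) = (\<lambda>x. (deriv ^^ n) F (of_real x))"
proof (induction n)
  case 0
  then show ?case by (simp add: nth_vector_derivative_def)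
next
  case (Suc n)
  have "vector_derivative (\<lambda>x. (deriv ^^ n) F (of_real x)) (at x) = (deriv ^^ Suc n) F (of_real x)" for x
    using assms
    by (intro vector_derivative_at has_vector_derivative_real_field has_field_derivative_higher_deriv) auto
  then show ?case
    using Suc by (simp add: nth_vector_derivative_def)
qed

lemma smooth_of_real:
  assumes "F holomorphic_on S" "open S" "range complex_of_real \<subseteq> S"
  shows "smooth (\<lambda>x. F (of_real x))"
proof -
  have "((\<lambda>x. (deriv ^^ n) F (of_real x)) has_vector_derivative (deriv ^^ Suc n) F (of_real x)) (at x)" for x n
    using assms by (intro has_vector_derivative_real_field has_field_derivative_higher_deriv) auto
  then show ?thesis
    unfolding smooth_def nth_vector_derivative_of_real[OF assms]
    using differentiableI_vector by blast
qed

section \<open>Derivatives of a slowly varying function times a linear exponential\<close>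

lemma higher_deriv_exp_linear:
  fixes \<mu> c z :: complex
  shows "(deriv ^^ n) (\<lambda>w. exp (\<mu> * w + c)) z = \<mu> ^ n * exp (\<mu> * z + c)"
proof (induction n arbitrary: z)
  case (Suc n)
  then have eq: "(deriv ^^ n) (\<lambda>w. exp (\<mu> * w + c)) = (\<lambda>z. \<mu> ^ n * exp (\<mu> * z + c))" by auto
  show ?case
    unfolding funpow.simps o_def eq
    by (rule DERIV_imp_deriv) (auto intro!: derivative_eq_intros)
qed simp

text \<open>Cauchy's inequality on the circle of radius \<open>r\<close> bounds the Leibniz term
  with \<open>i\<close> derivatives on \<open>U\<close> by \<open>M * q ^ i\<close> times the term
  with none, where \<open>q = n / (r * norm \<mu>)\<close>. Since \<open>large\<close> says
  \<open>4 * M * q \<le> 1\<close>, the terms with \<open>i \<ge> 1\<close> add up to at most half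
  of the leading one.\<close>

lemma norm_higher_deriv_mult_exp_ge:
  fixes \<mu> c z :: complex
  assumes "U holomorphic_on S" "open S" "cball z r \<subseteq> S" "r > 0" "\<mu> \<noteq> 0" "1 \<le> M"
    and U: "\<And>w. norm (z - w) = r \<Longrightarrow> norm (U w) \<le> M * norm (U z)"
    and large: "4 * M * real n \<le> r * norm \<mu>"
  shows "norm \<mu> ^ n * norm (exp (\<mu> * z + c)) * norm (U z) / 2
           \<le> norm ((deriv ^^ n) (\<lambda>w. U w * exp (\<mu> * w + c)) z)"
proof -
  define q where "q = real n / (r * norm \<mu>)"
  define L where "L = norm \<mu> ^ n * norm (exp (\<mu> * z + c)) * norm (U z)"
  define T where "T i = of_nat (n choose i) * (deriv ^^ i) U z * (\<mu> ^ (n - i) * exp (\<mu> * z + c))" for i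
  have "L \<ge> 0" by (simp add: L_def)
  have q: "0 \<le> q" "4 * M * q \<le> 1"
    using assms by (auto simp: q_def field_simps)
  then have q4: "4 * q \<le> 1"
    using mult_right_mono[OF \<open>1 \<le> M\<close> q(1)] by linarith
  have "z \<in> S" using assms(3,4) by auto
  have sum: "(deriv ^^ n) (\<lambda>w. U w * exp (\<mu> * w + c)) z = (\<Sum>i=0..n. T i)"
    unfolding T_def
    by (subst higher_deriv_mult[OF assms(1) _ assms(2) \<open>z \<in> S\<close>])
       (auto intro!: holomorphic_intros simp: higher_deriv_exp_linear)
  have U_deriv: "norm ((deriv ^^ i) U z) \<le> fact i * (M * norm (U z)) / r ^ i" for i
  proof (rule Cauchy_inequality)
    show "U holomorphic_on ball z r" "continuous_on (cball z r) U"
      using assms(1,3) ball_subset_cball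
      by (blast intro: holomorphic_on_subset holomorphic_on_imp_continuous_on)+
  qed (use assms in auto)
  have T: "norm (T i) \<le> L * M * q ^ i" if "i \<le> n" for i
  proof -
    \<comment> \<open>This absorbs the factorial of Cauchy's inequality into \<open>n ^ i\<close>,
      the numerator of \<open>q ^ i\<close>.\<close>
    have choose: "real (n choose i) * fact i \<le> real n ^ i"
      using binomial_fact_pow[of n i] by (metis of_nat_fact of_nat_le_iff of_nat_mult of_nat_power)
    have "norm (T i) = real (n choose i) * norm ((deriv ^^ i) U z) * (norm \<mu> ^ (n - i) * norm (exp (\<mu> * z + c)))"
      by (simp add: T_def norm_mult norm_power)
    also have "\<dots> \<le> real (n choose i) * (fact i * (M * norm (U z)) / r ^ i) * (norm \<mu> ^ (n - i) * norm (exp (\<mu> * z + c)))"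
      by (intro mult_right_mono mult_left_mono U_deriv) auto
    also have "\<dots> = (real (n choose i) * fact i) * (M * norm (U z) / r ^ i * (norm \<mu> ^ (n - i) * norm (exp (\<mu> * z + c))))"
      by simp
    also have "\<dots> \<le> real n ^ i * (M * norm (U z) / r ^ i * (norm \<mu> ^ (n - i) * norm (exp (\<mu> * z + c))))"
      using choose assms(4,6) by (intro mult_right_mono) auto
    also have "\<dots> = L * M * q ^ i"
      using assms(4,5) that
      by (simp add: L_def q_def power_diff power_divide power_mult_distrib field_simps)
    finally show ?thesis .
  qed
  have "norm (\<Sum>i=1..n. T i) \<le> (\<Sum>i=1..n. L * M * q ^ i)"
    by (rule sum_norm_le) (use T in auto)
  also have "\<dots> = L * (M * q * (\<Sum>i<n. q ^ i))"
    by (simp add: sum_distrib_left sum.atLeast1_atMost_eq mult_ac)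
  also have "\<dots> \<le> L * (1 / 2)"
  proof (rule mult_left_mono)
    have "(\<Sum>i<n. q ^ i) * (1 - q) \<le> 1"
      using one_diff_power_eq[of q n] zero_le_power[OF q(1), of n] by (simp add: mult.commute)
    \<comment> \<open>As \<open>q \<le> 1 / 4\<close>, the geometric sum is at most 4/3; the rounder
      bound 2 suffices.\<close>
    moreover have "(\<Sum>i<n. q ^ i) * (3 / 4) \<le> (\<Sum>i<n. q ^ i) * (1 - q)"
      using q q4 by (intro mult_left_mono sum_nonneg) auto
    ultimately have "(\<Sum>i<n. q ^ i) \<le> 2" by linarith
    then have "M * q * (\<Sum>i<n. q ^ i) \<le> M * q * 2"
      using q assms(6) by (intro mult_left_mono) auto
    then show "M * q * (\<Sum>i<n. q ^ i) \<le> 1 / 2" using q by linarith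
  qed (fact \<open>L \<ge> 0\<close>)
  finally have rest: "norm (\<Sum>i=1..n. T i) \<le> L / 2" by simp
  have "(\<Sum>i=0..n. T i) = T 0 + (\<Sum>i=1..n. T i)"
    by (simp add: sum.atLeast_Suc_atMost)
  moreover have "norm (T 0) = L"
    by (simp add: T_def L_def norm_mult norm_power)
  ultimately have "norm (\<Sum>i=0..n. T i) \<ge> L / 2"
    using norm_diff_ineq[of "T 0" "\<Sum>i=1..n. T i"] rest by simp
  then show ?thesis by (simp add: sum L_def)
qed

section \<open>The witness and its membership in the space\<close>

text \<open>A version of \<open>exp (- (\<bar>x\<bar> powr (2 * a)))\<close> without the singularity
  at 0. The branch points of the power move to \<open>\<i>\<close> and \<open>- \<i>\<close>, which
  fixes the width of \<open>strip\<close>.\<close>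

definition witness :: "real \<Rightarrow> complex \<Rightarrow> complex" where
  "witness a z = exp (- ((1 + z\<^sup>2) powr of_real a))"

definition strip :: "complex set" where
  "strip = {z. \<bar>Im z\<bar> < 1}"

lemma open_strip: "open strip"
  unfolding strip_def by (intro open_Collect_less continuous_intros)

lemma range_of_real_strip: "range complex_of_real \<subseteq> strip"
  by (auto simp: strip_def)

lemma Re_one_plus_square_pos:
  assumes "z \<in> strip"
  shows "0 < Re (1 + z\<^sup>2)"
proof -
  have "\<bar>Im z\<bar>\<^sup>2 < 1"
    using assms by (subst power_less_one_iff) (auto simp: strip_def)
  then show ?thesis by (simp add: add_strict_increasing2 power2_eq_square) (smt (verit) zero_le_square)
qed

lemma one_plus_square_notin_nonpos_Reals:
  "z \<in> strip \<Longrightarrow> 1 + z\<^sup>2 \<notin> \<real>\<^sub>\<le>\<^sub>0"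
  using Re_one_plus_square_pos complex_nonpos_Reals_iff by fastforce

lemma holomorphic_witness: "witness a holomorphic_on strip"
  unfolding witness_def
  by (intro holomorphic_intros) (auto dest: one_plus_square_notin_nonpos_Reals)

lemma witness_of_real: "witness a (of_real x) = of_real (exp (- ((1 + x\<^sup>2) powr a)))"
proof -
  have "(1 + (of_real x)\<^sup>2 :: complex) powr of_real a = of_real ((1 + x\<^sup>2) powr a)"
    using powr_of_real[of "1 + x\<^sup>2" a] by simp
  then show ?thesis by (simp add: witness_def flip: exp_of_real)
qed

text \<open>The function estimated is the derivative of the exponent in \<open>witness\<close>. With
  \<open>p = norm (1 + z\<^sup>2) \<ge> 3 / 4\<close> one has
  \<open>norm z \<le> 2 * p powr (1 / 2)\<close>, so the derivative is of order
  \<open>p powr (a - 1 / 2)\<close>, which stays bounded because \<open>a < 1 / 2\<close>.\<close>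

lemma norm_deriv_power_le:
  assumes "0 < a" "a < 1 / 2" "\<bar>Im z\<bar> \<le> 1 / 2"
  shows "norm (of_real a * (1 + z\<^sup>2) powr (of_real a - 1) * (2 * z)) \<le> 4"
proof -
  define p where "p = norm (1 + z\<^sup>2)"
  have "\<bar>Im z\<bar>\<^sup>2 \<le> (1 / 2)\<^sup>2" using assms(3) by (intro power_mono) auto
  then have "3 / 4 \<le> Re (1 + z\<^sup>2)"
    by (simp add: power2_eq_square) (smt (verit) zero_le_square)
  then have p: "3 / 4 \<le> p"
    using complex_Re_le_cmod[of "1 + z\<^sup>2"] by (simp add: p_def)
  have "(norm z)\<^sup>2 = norm ((1 + z\<^sup>2) - 1)" by (simp add: norm_power)
  also have "\<dots> \<le> p + 1" unfolding p_def by (rule norm_triangle_le_diff) simp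
  also have "\<dots> \<le> 4 * p" using p by simp
  finally have "norm z \<le> sqrt (4 * p)" by (rule real_le_rsqrt)
  then have z: "norm z \<le> 2 * p powr (1 / 2)"
    using p by (simp add: real_sqrt_mult powr_half_sqrt)
  have "p powr (a - 1) * p powr (1 / 2) = p powr (a - 1 / 2)"
    by (simp flip: powr_add)
  also have "\<dots> \<le> (3 / 4) powr (a - 1 / 2)"
    using p assms by (intro powr_mono2') auto
  \<comment> \<open>The base is below 1, so lowering the exponent increases the power.\<close>
  also have "\<dots> \<le> (3 / 4) powr (- 1)"
    using assms by (intro powr_mono') auto
  also have "\<dots> = 4 / 3" by (simp add: powr_minus)
  finally have pp: "p powr (a - 1) * p powr (1 / 2) \<le> 4 / 3" .
  have "norm (of_real a * (1 + z\<^sup>2) powr (of_real a - 1) * (2 * z)) = 2 * a * (p powr (a - 1) * norm z)"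
    using assms norm_powr_real_powr'[of "of_real a - 1" "1 + z\<^sup>2"] by (simp add: norm_mult p_def)
  also have "\<dots> \<le> 2 * a * (p powr (a - 1) * (2 * p powr (1 / 2)))"
    using z assms by (intro mult_left_mono) auto
  also have "\<dots> \<le> 2 * a * (2 * (4 / 3))"
    using pp assms by (intro mult_left_mono) auto
  also have "\<dots> \<le> 4" using assms by simp
  finally show ?thesis .
qed

text \<open>By the mean value inequality on a convex strip, the exponent changes by at most 4 times
  the distance, hence by at most 2.\<close>

lemma norm_witness_le:
  assumes "0 < a" "a < 1 / 2" "norm (w - of_real x) \<le> 1 / 2"
  shows "norm (witness a w) \<le> exp 2 * norm (witness a (of_real x))"
proof -
  define T :: "complex set" where "T = {z. \<bar>Im z\<bar> \<le> 1 / 2}"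
  have "T = {z. Im z \<le> 1 / 2} \<inter> {z. Im z \<ge> - (1 / 2)}" by (auto simp: T_def)
  then have "convex T"
    using convex_halfspace_Im_le convex_halfspace_Im_ge by (simp only: convex_Int)
  have "w \<in> T" "of_real x \<in> T"
    using abs_Im_le_cmod[of "w - of_real x"] assms by (auto simp: T_def)
  have D: "((\<lambda>z. (1 + z\<^sup>2) powr of_real a) has_field_derivative
      of_real a * (1 + z\<^sup>2) powr (of_real a - 1) * (2 * z)) (at z within T)" if "z \<in> T" for z
  proof -
    have "1 + z\<^sup>2 \<notin> \<real>\<^sub>\<le>\<^sub>0"
      using that one_plus_square_notin_nonpos_Reals by (auto simp: T_def strip_def)
    moreover have "((\<lambda>z. 1 + z\<^sup>2) has_field_derivative 2 * z) (at z within T)"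
      by (auto intro!: derivative_eq_intros)
    ultimately show ?thesis by (intro DERIV_chain2[OF has_field_derivative_powr])
  qed
  have "norm ((1 + (of_real x)\<^sup>2) powr of_real a - (1 + w\<^sup>2) powr of_real a) \<le> 4 * norm (of_real x - w)"
    using field_differentiable_bound[OF \<open>convex T\<close> D _ \<open>of_real x \<in> T\<close> \<open>w \<in> T\<close>] norm_deriv_power_le assms
    by (auto simp: T_def)
  also have "\<dots> \<le> 2" using assms by (simp add: norm_minus_commute)
  finally have "Re ((1 + (of_real x)\<^sup>2) powr of_real a - (1 + w\<^sup>2) powr of_real a) \<le> 2"
    using complex_Re_le_cmod order_trans by blast
  then show ?thesis
    by (simp add: witness_def flip: exp_add)
qed

lemma cball_subset_strip: "cball (of_real x) (1 / 2) \<subseteq> strip"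
proof
  fix w assume "w \<in> cball (complex_of_real x) (1 / 2)"
  then have "\<bar>Im (of_real x - w)\<bar> \<le> 1 / 2"
    using abs_Im_le_cmod[of "of_real x - w"] unfolding mem_cball dist_norm by linarith
  then show "w \<in> strip" by (simp add: strip_def)
qed

lemma norm_higher_deriv_witness_le:
  assumes "0 < a" "a < 1 / 2"
  shows "norm ((deriv ^^ n) (witness a) (of_real x))
           \<le> fact n * (exp 2 * exp (- (\<bar>x\<bar> powr (2 * a)))) * 2 ^ n"
proof -
  have "norm ((deriv ^^ n) (witness a) (of_real x))
      \<le> fact n * (exp 2 * norm (witness a (of_real x))) / (1 / 2) ^ n"
  proof (rule Cauchy_inequality)
    show "witness a holomorphic_on ball (of_real x) (1 / 2)"
      "continuous_on (cball (of_real x) (1 / 2)) (witness a)"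
      using holomorphic_witness cball_subset_strip ball_subset_cball
      by (meson holomorphic_on_subset holomorphic_on_imp_continuous_on order_trans)+
    show "norm (witness a w) \<le> exp 2 * norm (witness a (of_real x))"
      if "norm (of_real x - w) = 1 / 2" for w
      using that assms by (intro norm_witness_le) (auto simp: norm_minus_commute)
  qed simp
  also have "\<dots> = fact n * (exp 2 * norm (witness a (of_real x))) * 2 ^ n"
    by (simp add: power_divide)
  also have "\<dots> \<le> fact n * (exp 2 * exp (- (\<bar>x\<bar> powr (2 * a)))) * 2 ^ n"
  proof -
    have "\<bar>x\<bar> powr (2 * a) = (\<bar>x\<bar> powr 2) powr a" by (simp only: powr_powr)
    also have "\<dots> = (x\<^sup>2) powr a" by (simp only: powr_numeral abs_ge_zero power2_abs)
    also have "\<dots> \<le> (1 + x\<^sup>2) powr a" using assms by (intro powr_mono2) auto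
    finally show ?thesis by (simp add: witness_of_real)
  qed
  finally show ?thesis .
qed

text \<open>The constants are \<open>C = 2\<close>, cancelling the \<open>2 ^ n\<close> from
  Cauchy's inequality at radius 1/2, and \<open>c = 1\<close>, cancelling the decay exactly. The
  factorial cancels because \<open>s \<ge> 1\<close>.\<close>

lemma witness_in_gelfand_shilov:
  assumes "1 \<le> s" "1 < \<theta>"
  shows "(\<lambda>x. witness (1 / (2 * \<theta>)) (of_real x)) \<in> gelfand_shilov s \<theta>"
proof -
  define a where "a = 1 / (2 * \<theta>)"
  have a: "0 < a" "a < 1 / 2" "2 * a = 1 / \<theta>" using assms by (auto simp: a_def field_simps)
  have "norm ((deriv ^^ n) (witness a) (of_real x)) * 2 powr (- real n) * fact n powr (- s)
      * exp (1 * \<bar>x\<bar> powr (1 / \<theta>)) \<le> exp 2" for n x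
  proof -
    have "norm ((deriv ^^ n) (witness a) (of_real x)) * 2 powr (- real n) * fact n powr (- s)
        * exp (1 * \<bar>x\<bar> powr (1 / \<theta>))
      \<le> (fact n * (exp 2 * exp (- (\<bar>x\<bar> powr (2 * a)))) * 2 ^ n) * 2 powr (- real n) * fact n powr (- 1)
        * exp (1 * \<bar>x\<bar> powr (1 / \<theta>))"
      using assms a
      by (intro mult_mono norm_higher_deriv_witness_le powr_mono) (auto simp: fact_ge_1)
    also have "\<dots> = exp 2"
      unfolding a(3) by (simp add: powr_minus powr_realpow exp_minus field_simps)
    finally show ?thesis .
  qed
  then have "bdd_above (range (\<lambda>(\<xi>::real, \<beta>::nat).
      norm ((deriv ^^ \<beta>) (witness a) (of_real \<xi>)) * 2 powr (- real \<beta>) * fact \<beta> powr (- s)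
        * exp (1 * \<bar>\<xi>\<bar> powr (1 / \<theta>))))"
    by (intro bdd_aboveI[of _ "exp 2"]) auto
  moreover have "smooth (\<lambda>x. witness a (of_real x))"
    using holomorphic_witness open_strip range_of_real_strip by (rule smooth_of_real)
  ultimately show ?thesis
    unfolding gelfand_shilov_def mem_Collect_eq a_def[symmetric]
      nth_vector_derivative_of_real[OF holomorphic_witness open_strip range_of_real_strip]
    by (intro conjI exI[of _ 2] exI[of _ 1]) auto
qed

section \<open>Lower bound for the derivatives of the product\<close>

definition modulated :: "real \<Rightarrow> real \<Rightarrow> complex \<Rightarrow> complex" where
  "modulated t a z = exp (- \<i> * (of_real t * z\<^sup>2)) * witness a z"

lemma holomorphic_modulated: "modulated t a holomorphic_on strip"
  unfolding modulated_def by (intro holomorphic_intros holomorphic_witness)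

lemma norm_higher_deriv_modulated_ge:
  assumes "0 < a" "a < 1 / 2" "t > 0" "x > 0"
    and large: "4 * exp (t + 2) * real n \<le> t * x"
  shows "(2 * t * x) ^ n * exp (- ((1 + x\<^sup>2) powr a)) / 2
           \<le> norm ((deriv ^^ n) (modulated t a) (of_real x))"
proof -
  \<comment> \<open>Expanding the phase at \<open>x\<close> leaves a linear part of frequency
    \<open>2 * t * x\<close> and a quadratic remainder, kept in \<open>U\<close>. On the circle of
    radius 1/2 the remainder costs at most \<open>exp t\<close> and the witness
    \<open>exp 2\<close>, whence \<open>M = exp (t + 2)\<close>.\<close>
  define U where "U z = exp (- \<i> * (of_real t * (z - of_real x)\<^sup>2)) * witness a z" for z
  define \<mu> where "\<mu> = - \<i> * of_real (2 * t * x)"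
  define c where "c = \<i> * of_real (t * x\<^sup>2)"
  have norm_\<mu>: "norm \<mu> = 2 * t * x" using assms by (simp add: \<mu>_def norm_mult)
  have U_x: "U (of_real x) = witness a (of_real x)" by (simp add: U_def)
  have eq: "modulated t a = (\<lambda>z. U z * exp (\<mu> * z + c))"
  proof
    fix z
    have "exp (- \<i> * (of_real t * z\<^sup>2)) = exp (- \<i> * (of_real t * (z - of_real x)\<^sup>2) + (\<mu> * z + c))"
      by (rule arg_cong[of _ _ exp]) (simp add: \<mu>_def c_def power2_eq_square algebra_simps)
    then show "modulated t a z = U z * exp (\<mu> * z + c)"
      unfolding modulated_def U_def exp_add by (simp only: mult_ac)
  qed
  have "norm \<mu> ^ n * norm (exp (\<mu> * of_real x + c)) * norm (U (of_real x)) / 2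
      \<le> norm ((deriv ^^ n) (\<lambda>w. U w * exp (\<mu> * w + c)) (of_real x))"
  proof (rule norm_higher_deriv_mult_exp_ge)
    show "U holomorphic_on strip"
      unfolding U_def by (intro holomorphic_intros holomorphic_witness)
    show "open strip" "cball (of_real x) (1 / 2) \<subseteq> strip"
      by (rule open_strip cball_subset_strip)+
    show "\<mu> \<noteq> 0" using assms by (simp add: \<mu>_def)
    show "1 \<le> exp (t + 2)" using assms by simp
    show "4 * exp (t + 2) * real n \<le> 1 / 2 * norm \<mu>" using large by (simp add: norm_\<mu>)
    fix w :: complex assume w: "norm (of_real x - w) = 1 / 2"
    have "norm (exp (- \<i> * (of_real t * (w - of_real x)\<^sup>2))) \<le> exp (norm (- \<i> * (of_real t * (w - of_real x)\<^sup>2)))"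
      by (rule norm_exp)
    also have "\<dots> \<le> exp t"
    proof -
      have "norm (w - of_real x) ^ 2 \<le> 1"
        using w by (intro power_le_one) (auto simp: norm_minus_commute)
      then show ?thesis using assms by (simp add: norm_mult norm_power)
    qed
    finally have "norm (U w) \<le> exp t * (exp 2 * norm (witness a (of_real x)))"
      unfolding U_def norm_mult using w assms
      by (intro mult_mono norm_witness_le) (auto simp: norm_minus_commute)
    then show "norm (U w) \<le> exp (t + 2) * norm (U (of_real x))"
      by (simp add: U_x exp_add)
  qed simp
  moreover have "norm (exp (\<mu> * of_real x + c)) = 1"
    by (simp add: \<mu>_def c_def)
  ultimately show ?thesis
    by (simp add: eq norm_\<mu> U_x witness_of_real)
qed

section \<open>Contradiction at the points \<open>n powr \<theta>\<close>\<close>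

theorem proposition2:
  fixes s \<theta> t :: real
  assumes "1 \<le> s" and "s < \<theta>" and "t > 0"
  shows "\<not> gelfand_shilov_multiplier s \<theta> (\<lambda>\<xi>. exp (- \<i> * complex_of_real (t * \<xi>\<^sup>2)))"
proof
  assume mult: "gelfand_shilov_multiplier s \<theta> (\<lambda>\<xi>. exp (- \<i> * complex_of_real (t * \<xi>\<^sup>2)))"
  define a where "a = 1 / (2 * \<theta>)"
  have a: "0 < a" "a < 1 / 2" "2 * \<theta> * a = 1" using assms by (auto simp: a_def field_simps)
  have "(\<lambda>\<xi>. exp (- \<i> * complex_of_real (t * \<xi>\<^sup>2)) * witness a (of_real \<xi>)) \<in> gelfand_shilov s \<theta>"
    using mult witness_in_gelfand_shilov[of s \<theta>] assms
    by (auto simp: gelfand_shilov_multiplier_def a_def)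
  then have "(\<lambda>\<xi>. modulated t a (of_real \<xi>)) \<in> gelfand_shilov s \<theta>"
    by (simp add: modulated_def)
  then obtain C c K where C: "C > 0" "c > 0" and K: "\<And>\<xi> n.
      norm ((deriv ^^ n) (modulated t a) (of_real \<xi>)) * C powr (- real n) * fact n powr (- s)
        * exp (c * \<bar>\<xi>\<bar> powr (1 / \<theta>)) \<le> K"
    unfolding gelfand_shilov_def mem_Collect_eq
      nth_vector_derivative_of_real[OF holomorphic_modulated open_strip range_of_real_strip]
    by (fastforce simp: bdd_above_def)
  \<comment> \<open>At \<open>x = n powr \<theta>\<close> the lower bound, divided by
    \<open>C ^ n\<close> and \<open>n powr (s * n)\<close>, is half the \<open>n\<close>-th power of
    \<open>b * n powr (\<theta> - s)\<close>; this base is unbounded since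
    \<open>s < \<theta>\<close>.\<close>
  define b where "b = 2 * t * exp (- 2) / C"
  have "b > 0" "\<theta> - s > 0" "\<theta> > 1" using assms C by (auto simp: b_def)
  have "\<forall>\<^sub>F n in sequentially. 2 \<le> b * real n powr (\<theta> - s)"
    using \<open>b > 0\<close> \<open>\<theta> - s > 0\<close> by real_asymp
  moreover have "\<forall>\<^sub>F n in sequentially. 4 * exp (t + 2) * real n \<le> t * real n powr \<theta>"
    using \<open>\<theta> > 1\<close> \<open>t > 0\<close> by real_asymp
  moreover have "\<forall>\<^sub>F n in sequentially. K < 2 ^ n / 2"
    by real_asymp
  ultimately have "\<forall>\<^sub>F n in sequentially. n > 0 \<and> 2 \<le> b * real n powr (\<theta> - s)
      \<and> 4 * exp (t + 2) * real n \<le> t * real n powr \<theta> \<and> K < 2 ^ n / 2"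
    using eventually_gt_at_top[of 0] by eventually_elim auto
  then obtain n :: nat where n: "n > 0" "2 \<le> b * real n powr (\<theta> - s)"
      "4 * exp (t + 2) * real n \<le> t * real n powr \<theta>" "K < 2 ^ n / 2"
    using eventually_happens' sequentially_bot by blast
  \<comment> \<open>Since \<open>2 * \<theta> * a = 1\<close>, this choice gives
    \<open>(x\<^sup>2) powr a = n\<close>, so the witness costs at most a factor
    \<open>exp (- 2)\<close> per derivative.\<close>
  define x where "x = real n powr \<theta>"
  have x: "x \<ge> 1" using n assms by (auto simp: x_def intro!: ge_one_powr_ge_zero)
  have "(1 + x\<^sup>2) powr a \<le> (2 * x\<^sup>2) powr a"
    using x a one_le_power[OF x, of 2] by (intro powr_mono2) auto
  also have "\<dots> = 2 powr a * real n"
  proof -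
    have "x\<^sup>2 = real n powr (2 * \<theta>)"
      using n by (simp add: x_def power2_eq_square flip: powr_add)
    then show ?thesis using n a by (simp add: powr_mult powr_powr)
  qed
  also have "\<dots> \<le> 2 * real n"
    using a powr_mono[of a 1 "2::real"] by (intro mult_right_mono) auto
  finally have decay: "exp (- 2 * real n) \<le> exp (- ((1 + x\<^sup>2) powr a))" by simp
  have "fact n powr s \<le> (real n ^ n) powr s"
    using assms fact_le_power[of n, where 'a = real] by (intro powr_mono2) auto
  also have "\<dots> = (real n powr s) ^ n"
    using n by (simp add: powr_powr mult.commute flip: powr_realpow)
  finally have fact: "(1 / real n powr s) ^ n \<le> fact n powr (- s)"
    using n by (simp add: powr_minus power_divide field_simps)
  have "2 ^ n / 2 \<le> (b * real n powr (\<theta> - s)) ^ n / 2"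
    using n by (intro divide_right_mono power_mono) auto
  also have "\<dots> = (2 * t * x) ^ n * exp (- 2 * real n) / 2 * (1 / C) ^ n * (1 / real n powr s) ^ n"
  proof -
    have "exp (- 2 * real n) = exp (- 2) ^ n" by (simp add: mult.commute flip: exp_of_nat_mult)
    moreover have "b * real n powr (\<theta> - s) = 2 * t * x * exp (- 2) * (1 / C) * (1 / real n powr s)"
      by (simp add: b_def x_def powr_diff)
    ultimately show ?thesis by (simp only: power_mult_distrib) simp
  qed
  also have "\<dots> \<le> norm ((deriv ^^ n) (modulated t a) (of_real x)) * C powr (- real n) * fact n powr (- s)"
  proof (intro mult_mono fact)
    have "(2 * t * x) ^ n * exp (- 2 * real n) / 2 \<le> (2 * t * x) ^ n * exp (- ((1 + x\<^sup>2) powr a)) / 2"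
      using decay x assms by (intro divide_right_mono mult_left_mono) auto
    also have "\<dots> \<le> norm ((deriv ^^ n) (modulated t a) (of_real x))"
      using a assms x n by (intro norm_higher_deriv_modulated_ge) (auto simp: x_def)
    finally show "(2 * t * x) ^ n * exp (- 2 * real n) / 2
        \<le> norm ((deriv ^^ n) (modulated t a) (of_real x))" .
    show "(1 / C) ^ n \<le> C powr (- real n)"
      using C by (simp add: powr_minus powr_realpow power_divide field_simps)
  qed (use C x assms in auto)
  also have "\<dots> \<le> norm ((deriv ^^ n) (modulated t a) (of_real x)) * C powr (- real n) * fact n powr (- s)
      * exp (c * \<bar>x\<bar> powr (1 / \<theta>))"
    using C by (auto simp: mult_le_cancel_left1 mult_less_0_iff)
  also have "\<dots> \<le> K" by (rule K)
  finally show False using n by simp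
qed

end
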